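(* For any integer $k>0$, the class of $k$-locally testable groups is closed under taking finite direct products: if $G_1,\dots,G_n$ ($n\ge 1$) are $k$-locally testable groups, then $G_1\times\cdots\times G_n$ is $k$-locally testable.
   Context: A generating set $X$ of a group $G$ is symmetric if it is closed under taking inverses; it is allowed to contain the identity element. For a finite symmetric generating set $X$ of $G$, $\mathrm{Geo}(G,X)\subseteq X^*$ denotes the set of all words over $X$ that label geodesic paths in the Cayley graph of $G$ with respect to $X$, i.e. the words $w$ such that no strictly shorter word over $X$ represents the same element of $G$ as $w$. For a finite set $X$, a natural number $k>0$ and $u\in X^*$ of length $l(u)\ge k$, let $\mathrm{pre}_k(u)$ and $\mathrm{suf}_k(u)$ be the prefix and suffix of $u$ of length $k$, and $\mathrm{sub}_k(u)$ the set of all contiguous subwords of $u$ of length $k$; if $l(u)<k$ put $\mathrm{pre}_k(u)=\mathrm{suf}_k(u)=u$ and $\mathrm{sub}_k(u)=\emptyset$; $\mathrm{pre}_0(u)$ and $\mathrm{suf}_0(u)$ are the empty word. Write $u\sim_k v$ if $\mathrm{pre}_{k-1}(u)=\mathrm{pre}_{k-1}(v)$, $\mathrm{suf}_{k-1}(u)=\mathrm{suf}_{k-1}(v)$ and $\mathrm{sub}_k(u)=\mathrm{sub}_k(v)$. A language $L\subseteq X^*$ is $k$-locally testable if it is a union of equivalence classes of $\sim_k$. A group $G$ is $k$-locally testable if $\mathrm{Geo}(G,X)$ is $k$-locally testable for some finite symmetric generating set $X$ of $G$. *)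

theory Defs
  imports "HOL-Algebra.Product_Groups" "HOL-Library.Sublist"
begin

definition pre :: "nat \<Rightarrow> 'a list \<Rightarrow> 'a list" where
  "pre k u = take k u"

(* Truncated subtraction makes this u itself when length u < k. *)
definition suf :: "nat \<Rightarrow> 'a list \<Rightarrow> 'a list" where
  "suf k u = drop (length u - k) u"

(* sublist is the contiguous-subword relation, so the set is empty when length u < k. *)
definition sub :: "nat \<Rightarrow> 'a list \<Rightarrow> 'a list set" where
  "sub k u = {v. sublist v u \<and> length v = k}"

(* The relation sim_k on words over X; only meaningful for k > 0. *)
definition sim_rel :: "nat \<Rightarrow> 'a set \<Rightarrow> ('a list \<times> 'a list) set" where
  "sim_rel k X = {(u, v). u \<in> lists X \<and> v \<in> lists X \<and>
     pre (k - 1) u = pre (k - 1) v \<and> suf (k - 1) u = suf (k - 1) v \<and> sub k u = sub k v}"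

definition locally_testable :: "nat \<Rightarrow> 'a set \<Rightarrow> 'a list set \<Rightarrow> bool" where
  "locally_testable k X L \<longleftrightarrow> (\<exists>C \<subseteq> lists X // sim_rel k X. L = \<Union>C)"

definition word_value :: "('a, 'b) monoid_scheme \<Rightarrow> 'a list \<Rightarrow> 'a" where
  "word_value G w = foldr (\<otimes>\<^bsub>G\<^esub>) w \<one>\<^bsub>G\<^esub>"

definition Geo :: "('a, 'b) monoid_scheme \<Rightarrow> 'a set \<Rightarrow> 'a list set" where
  "Geo G X = {w \<in> lists X.
     \<not> (\<exists>v \<in> lists X. length v < length w \<and> word_value G v = word_value G w)}"

definition symmetric_generating_set :: "('a, 'b) monoid_scheme \<Rightarrow> 'a set \<Rightarrow> bool" where
  "symmetric_generating_set G X \<longleftrightarrow>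
     X \<subseteq> carrier G \<and> generate G X = carrier G \<and> (\<forall>x\<in>X. inv\<^bsub>G\<^esub> x \<in> X)"

definition locally_testable_group :: "nat \<Rightarrow> ('a, 'b) monoid_scheme \<Rightarrow> bool" where
  "locally_testable_group k G \<longleftrightarrow> group G \<and>
     (\<exists>X. finite X \<and> symmetric_generating_set G X \<and> locally_testable k X (Geo G X))"

end

theory Submission
  imports Defs
begin

text \<open>
  The identity may be added to a generating set: no geodesic word contains the identity letter, so
  the geodesic language stays the same, and it stays \<open>k\<close>-locally testable over the larger alphabet
  because the class of a word under the testing relation determines the letters that occur in it
  (lemma \<open>locally_testable_superset\<close>).

  So let each factor \<open>G i\<close> have a generating set \<open>X i\<close> that contains the identity, and generate the
  product by the full Cartesian product of the sets \<open>X i\<close>. A word over this alphabet is a family of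
  words of one common length, one over each \<open>X i\<close>, read in parallel. Component words of different
  lengths can be brought to a common length by appending identity letters, so the word length of an
  element of the product is the maximum of the word lengths of its components. Hence a word is
  geodesic iff at least one of its component words is geodesic (lemma \<open>Geo_product\<close>): the geodesic
  language of the product is a finite union of preimages of the languages of the factors under
  letter-to-letter maps. Preimages and unions preserve local testability, because a letter-to-letter
  map sends equivalent words to equivalent words (lemma \<open>sim_rel_map\<close>).

  The disjoint union of the sets \<open>X i\<close>, the more usual generating set of a product, would not do: its
  geodesics are the shuffles of geodesics of the factors, and there a forbidden subword of one factor
  may be spread out arbitrarily far by letters of another.
\<close>

section \<open>Local testability\<close>

lemma locally_testable_iff:
  "locally_testable k X L \<longleftrightarrow> L \<subseteq> lists X \<and> (\<forall>(u, v)\<in>sim_rel k X. u \<in> L \<longrightarrow> v \<in> L)"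
proof
  assume "locally_testable k X L"
  then obtain C where C: "C \<subseteq> lists X // sim_rel k X" "L = \<Union>C"
    by (auto simp: locally_testable_def)
  have equiv: "equiv (lists X) (sim_rel k X)"
    by (rule equivI) (auto simp: sim_rel_def refl_on_def sym_def trans_def)
  have "v \<in> L" if uv: "(u, v) \<in> sim_rel k X" and "u \<in> L" for u v
  proof -
    obtain c where c: "c \<in> C" "u \<in> c"
      using C(2) \<open>u \<in> L\<close> by blast
    then have "v \<in> c"
      using in_quotient_imp_closed[OF equiv _ _ uv] C(1) by blast
    with c C(2) show ?thesis by blast
  qed
  moreover have "L \<subseteq> lists X"
    using C in_quotient_imp_subset[OF equiv] by blast
  ultimately show "L \<subseteq> lists X \<and> (\<forall>(u, v)\<in>sim_rel k X. u \<in> L \<longrightarrow> v \<in> L)"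
    by blast
next
  assume L: "L \<subseteq> lists X \<and> (\<forall>(u, v)\<in>sim_rel k X. u \<in> L \<longrightarrow> v \<in> L)"
  define C where "C = (\<lambda>u. sim_rel k X `` {u}) ` L"
  have "C \<subseteq> lists X // sim_rel k X"
    using L by (auto simp: C_def quotient_def)
  moreover have "L = \<Union>C"
  proof
    show "L \<subseteq> \<Union>C"
      using L by (auto simp: C_def sim_rel_def)
    show "\<Union>C \<subseteq> L"
      using L by (auto simp: C_def)
  qed
  ultimately show "locally_testable k X L"
    by (auto simp: locally_testable_def)
qed

lemma sub_eq_empty_iff: "sub k u = {} \<longleftrightarrow> length u < k"
proof
  assume "sub k u = {}"
  then have "take k u \<notin> sub k u" by simp
  then show "length u < k"
    by (auto simp: sub_def)
next
  assume "length u < k"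
  then show "sub k u = {}"
    by (auto simp: sub_def dest: sublist_length_le)
qed

lemma ex_sub_containing_letter:
  assumes "k > 0" "k \<le> length v" "x \<in> set v"
  shows "\<exists>s\<in>sub k v. x \<in> set s"
proof -
  obtain p q where v: "v = p @ x # q"
    using assms(3) by (meson split_list)
  show ?thesis
  proof (cases "k \<le> length (x # q)")
    case True
    have "sublist (take k (x # q)) v"
      unfolding v by (rule sublist_order.order.trans[OF sublist_take sublist_append_leftI])
    with True have "take k (x # q) \<in> sub k v"
      by (simp add: sub_def)
    moreover have "x \<in> set (take k (x # q))"
      using assms(1) by (cases k) auto
    ultimately show ?thesis by blast
  next
    \<comment> \<open>Too few letters follow \<open>x\<close>, so the suffix of length \<open>k\<close> reaches back to \<open>x\<close>.\<close>
    case False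
    then have "drop (length v - k) v = drop (length v - k) p @ x # q"
      by (simp add: v)
    then have "x \<in> set (drop (length v - k) v)"
      by simp
    moreover have "drop (length v - k) v \<in> sub k v"
      using assms(2) by (simp add: sub_def)
    ultimately show ?thesis by blast
  qed
qed

text \<open>
  Words shorter than \<open>k\<close> are equivalent only to themselves, and in a longer word every letter lies in
  a subword of length \<open>k\<close>. So enlarging the alphabet does not enlarge the class of any word over the
  original one.
\<close>

lemma locally_testable_superset:
  assumes "k > 0" "X \<subseteq> Y" "locally_testable k X L"
  shows "locally_testable k Y L"
proof -
  have L: "L \<subseteq> lists X" "\<And>u v. (u, v) \<in> sim_rel k X \<Longrightarrow> u \<in> L \<Longrightarrow> v \<in> L"
    using assms(3) by (auto simp: locally_testable_iff)
  have "v \<in> L" if uv: "(u, v) \<in> sim_rel k Y" and u: "u \<in> L" for u v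
  proof (rule L(2)[OF _ u])
    have subs: "sub k u = sub k v" and pre: "pre (k - 1) u = pre (k - 1) v"
      using uv by (auto simp: sim_rel_def)
    have uX: "u \<in> lists X"
      using L(1) u by auto
    have "v \<in> lists X"
    proof (cases "length v < k")
      case True
      then have "length u < k"
        using subs sub_eq_empty_iff by metis
      with True have "u = v"
        using pre by (simp add: pre_def)
      with uX show ?thesis by simp
    next
      case False
      have "x \<in> X" if "x \<in> set v" for x
      proof -
        obtain s where s: "s \<in> sub k u" "x \<in> set s"
          using ex_sub_containing_letter[OF assms(1) _ \<open>x \<in> set v\<close>] False subs by force
        then show ?thesis
          using uX set_mono_sublist by (fastforce simp: sub_def)
      qed
      then show ?thesis by auto
    qed
    with uX uv show "(u, v) \<in> sim_rel k X"
      by (simp add: sim_rel_def)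
  qed
  with L(1) assms(2) show ?thesis
    by (auto simp: locally_testable_iff)
qed

lemma sub_map: "sub k (map f u) = map f ` sub k u"
proof
  show "sub k (map f u) \<subseteq> map f ` sub k u"
    unfolding sub_def using sublist_map_rightE by fastforce
  show "map f ` sub k u \<subseteq> sub k (map f u)"
    by (auto simp: sub_def map_mono_sublist)
qed

lemma sim_rel_map:
  assumes "f \<in> X \<rightarrow> Y" "(u, v) \<in> sim_rel k X"
  shows "(map f u, map f v) \<in> sim_rel k Y"
proof -
  have "pre (k - 1) (map f w) = map f (pre (k - 1) w)"
       "suf (k - 1) (map f w) = map f (suf (k - 1) w)" for w
    by (simp_all add: pre_def suf_def take_map drop_map)
  moreover have "map f w \<in> lists Y" if "w \<in> lists X" for w
    using assms(1) that by (auto simp: Pi_iff)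
  ultimately show ?thesis
    using assms(2) by (simp add: sim_rel_def sub_map)
qed

lemma locally_testable_preimage:
  assumes "f \<in> X \<rightarrow> Y" "locally_testable k Y L"
  shows "locally_testable k X {w \<in> lists X. map f w \<in> L}"
proof -
  have "map f v \<in> L" if "(u, v) \<in> sim_rel k X" "map f u \<in> L" for u v
    using assms(2) sim_rel_map[OF assms(1) that(1)] that(2) by (auto simp: locally_testable_iff)
  moreover have "v \<in> lists X" if "(u, v) \<in> sim_rel k X" for u v
    using that by (simp add: sim_rel_def)
  ultimately show ?thesis
    unfolding locally_testable_iff by blast
qed

lemma locally_testable_UN:
  assumes "\<And>i. i \<in> I \<Longrightarrow> locally_testable k X (L i)"
  shows "locally_testable k X (\<Union>i\<in>I. L i)"
  unfolding locally_testable_iff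
proof (intro conjI)
  show "(\<Union>i\<in>I. L i) \<subseteq> lists X"
    using assms by (simp add: locally_testable_iff UN_least)
  have "v \<in> L i" if "i \<in> I" "(u, v) \<in> sim_rel k X" "u \<in> L i" for i u v
    using assms[OF that(1)] that(2,3) unfolding locally_testable_iff by blast
  then show "\<forall>(u, v)\<in>sim_rel k X. u \<in> (\<Union>i\<in>I. L i) \<longrightarrow> v \<in> (\<Union>i\<in>I. L i)"
    by blast
qed

section \<open>Words and generating sets\<close>

lemma word_value_Nil [simp]: "word_value G [] = \<one>\<^bsub>G\<^esub>"
  by (simp add: word_value_def)

lemma word_value_Cons [simp]: "word_value G (x # w) = x \<otimes>\<^bsub>G\<^esub> word_value G w"
  by (simp add: word_value_def)

context group
begin

lemma word_value_closed: "w \<in> lists (carrier G) \<Longrightarrow> word_value G w \<in> carrier G"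
  by (induction w) auto

lemma word_value_append:
  assumes "u \<in> lists (carrier G)" "v \<in> lists (carrier G)"
  shows "word_value G (u @ v) = word_value G u \<otimes> word_value G v"
  using assms by (induction u) (auto simp: word_value_closed m_assoc)

lemma word_value_replicate_one: "word_value G (replicate m \<one>) = \<one>"
  by (induction m) auto

lemma word_value_filter_one:
  "w \<in> lists (carrier G) \<Longrightarrow> word_value G (filter (\<lambda>x. x \<noteq> \<one>) w) = word_value G w"
  by (induction w) (auto simp: word_value_closed)

lemma generate_eq_word_values:
  assumes "X \<subseteq> carrier G" "\<forall>x\<in>X. inv x \<in> X"
  shows "generate G X = word_value G ` lists X"
proof
  have carr: "lists X \<subseteq> lists (carrier G)"
    using assms(1) by (rule lists_mono)
  have letter: "x \<in> word_value G ` lists X" if "x \<in> X" for x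
    using that assms(1) by (auto intro!: image_eqI[of _ _ "[x]"])
  show "generate G X \<subseteq> word_value G ` lists X"
  proof
    fix g assume "g \<in> generate G X"
    then show "g \<in> word_value G ` lists X"
    proof induction
      case one
      show ?case by (auto intro!: image_eqI[of _ _ "[]"])
    next
      case (eng g h)
      then obtain u v where "u \<in> lists X" "g = word_value G u" "v \<in> lists X" "h = word_value G v"
        by auto
      then show ?case
        using carr by (intro image_eqI[of _ _ "u @ v"]) (simp_all add: word_value_append subset_iff)
    qed (use assms(2) letter in auto)
  qed
next
  have "word_value G w \<in> generate G X" if "w \<in> lists X" for w
    using that by (induction w) (auto intro: generate.one generate.incl generate.eng)
  then show "word_value G ` lists X \<subseteq> generate G X"
    by auto
qed

lemma symmetric_generating_set_iff_words:
  "symmetric_generating_set G X \<longleftrightarrow>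
     X \<subseteq> carrier G \<and> (\<forall>x\<in>X. inv x \<in> X) \<and> carrier G \<subseteq> word_value G ` lists X"
  using generate_eq_word_values[of X] generate_incl[of X]
  unfolding symmetric_generating_set_def by auto

lemma Geo_insert_one_subset:
  assumes "X \<subseteq> carrier G"
  shows "Geo G (insert \<one> X) \<subseteq> lists (X - {\<one>})"
proof
  fix w assume w: "w \<in> Geo G (insert \<one> X)"
  let ?f = "filter (\<lambda>x. x \<noteq> \<one>)"
  have wX: "w \<in> lists (insert \<one> X)"
    using w by (simp add: Geo_def)
  with assms have "word_value G (?f w) = word_value G w"
    by (intro word_value_filter_one) auto
  moreover have "?f w \<in> lists (insert \<one> X)"
    using wX by auto
  ultimately have "\<not> length (?f w) < length w"
    using w by (auto simp: Geo_def)
  then have "\<one> \<notin> set w"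
    using length_filter_less[of \<one> w "\<lambda>x. x \<noteq> \<one>"] by blast
  with wX show "w \<in> lists (X - {\<one>})"
    by auto
qed

lemma Geo_insert_one:
  assumes "X \<subseteq> carrier G"
  shows "Geo G (insert \<one> X) = Geo G X"
proof
  show "Geo G (insert \<one> X) \<subseteq> Geo G X"
    using Geo_insert_one_subset[OF assms] by (fastforce simp: Geo_def)
next
  show "Geo G X \<subseteq> Geo G (insert \<one> X)"
  proof
    fix w assume w: "w \<in> Geo G X"
    have False if v: "v \<in> lists (insert \<one> X)" "length v < length w"
      "word_value G v = word_value G w" for v
    proof -
      let ?v = "filter (\<lambda>x. x \<noteq> \<one>) v"
      have "v \<in> lists (carrier G)"
        using v(1) assms by auto
      then have "word_value G ?v = word_value G w"
        using v(3) by (simp add: word_value_filter_one)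
      moreover have "?v \<in> lists X" "length ?v < length w"
        using v by (auto intro: le_less_trans[OF length_filter_le])
      ultimately show False
        using w by (auto simp: Geo_def)
    qed
    with w show "w \<in> Geo G (insert \<one> X)"
      by (auto simp: Geo_def)
  qed
qed

lemma symmetric_generating_set_insert_one:
  assumes "symmetric_generating_set G X"
  shows "symmetric_generating_set G (insert \<one> X)"
proof -
  have "lists X \<subseteq> lists (insert \<one> X)"
    by (rule lists_mono) auto
  then have "word_value G ` lists X \<subseteq> word_value G ` lists (insert \<one> X)"
    by (rule image_mono)
  with assms show ?thesis
    unfolding symmetric_generating_set_iff_words by auto
qed

end

lemma locally_testable_groupE_one:
  assumes "locally_testable_group k G" "k > 0"
  obtains X where "finite X" "symmetric_generating_set G X" "\<one>\<^bsub>G\<^esub> \<in> X" "locally_testable k X (Geo G X)"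
proof -
  obtain X where X: "finite X" "symmetric_generating_set G X" "locally_testable k X (Geo G X)"
    and "group G"
    using assms(1) by (auto simp: locally_testable_group_def)
  interpret group G by fact
  have "Geo G (insert \<one>\<^bsub>G\<^esub> X) = Geo G X"
    using X(2) by (intro Geo_insert_one) (simp add: symmetric_generating_set_def)
  with X assms(2) have "locally_testable k (insert \<one>\<^bsub>G\<^esub> X) (Geo G (insert \<one>\<^bsub>G\<^esub> X))"
    by (auto intro: locally_testable_superset)
  with X show thesis
    by (intro that[of "insert \<one>\<^bsub>G\<^esub> X"]) (auto intro: symmetric_generating_set_insert_one)
qed

section \<open>Geodesics in a product of groups\<close>

lemma word_value_product:
  "i \<in> I \<Longrightarrow> word_value (product_group I G) w i = word_value (G i) (map (\<lambda>f. f i) w)"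
  by (induction w) auto

lemma map_component_lists: "i \<in> I \<Longrightarrow> w \<in> lists (\<Pi>\<^sub>E i\<in>I. X i) \<Longrightarrow> map (\<lambda>f. f i) w \<in> lists (X i)"
  by (auto simp: PiE_iff)

locale generated_groups =
  fixes I :: "'i set" and G :: "'i \<Rightarrow> ('a, 'b) monoid_scheme" and X :: "'i \<Rightarrow> 'a set"
  assumes finite_index: "finite I"
    and group: "i \<in> I \<Longrightarrow> group (G i)"
    and gens: "i \<in> I \<Longrightarrow> symmetric_generating_set (G i) (X i)"
    and one_gen: "i \<in> I \<Longrightarrow> \<one>\<^bsub>G i\<^esub> \<in> X i"
begin

lemma gens_carrier: "i \<in> I \<Longrightarrow> X i \<subseteq> carrier (G i)"
  using gens by (auto simp: symmetric_generating_set_def)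

lemma PiE_gens_carrier: "(\<Pi>\<^sub>E i\<in>I. X i) \<subseteq> carrier (product_group I G)"
  using gens_carrier by (simp add: PiE_mono)

text \<open>
  This lemma makes the word length in the product the maximum of the word lengths of the components.
  Each component word is padded with identity letters to length \<open>m\<close>, and the \<open>j\<close>th letters of the
  padded words together form the \<open>j\<close>th letter of the required word.
\<close>

lemma ex_product_word:
  assumes g: "g \<in> carrier (product_group I G)"
    and short: "\<And>i. i \<in> I \<Longrightarrow> \<exists>v\<in>lists (X i). length v \<le> m \<and> word_value (G i) v = g i"
  shows "\<exists>w\<in>lists (\<Pi>\<^sub>E i\<in>I. X i). length w = m \<and> word_value (product_group I G) w = g"
proof -
  obtain v where v: "\<And>i. i \<in> I \<Longrightarrow> v i \<in> lists (X i)" "\<And>i. i \<in> I \<Longrightarrow> length (v i) \<le> m"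
    "\<And>i. i \<in> I \<Longrightarrow> word_value (G i) (v i) = g i"
    using short by metis
  define p where "p i = v i @ replicate (m - length (v i)) \<one>\<^bsub>G i\<^esub>" for i
  define w where "w = map (\<lambda>j. \<lambda>i\<in>I. p i ! j) [0..<m]"
  have p_len: "length (p i) = m" and p_lists: "p i \<in> lists (X i)" if "i \<in> I" for i
    using v(1,2)[OF that] one_gen[OF that] by (auto simp: p_def)
  have p_val: "word_value (G i) (p i) = g i" if "i \<in> I" for i
  proof -
    interpret group "G i" by (rule group[OF that])
    have "v i \<in> lists (carrier (G i))"
      using v(1)[OF that] gens_carrier[OF that] by auto
    moreover from this have "word_value (G i) (v i) \<in> carrier (G i)"
      by (rule word_value_closed)
    moreover have "replicate n \<one>\<^bsub>G i\<^esub> \<in> lists (carrier (G i))" for n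
      by auto
    ultimately show ?thesis
      using v(3)[OF that] by (simp only: p_def word_value_append word_value_replicate_one r_one)
  qed
  have w: "w \<in> lists (\<Pi>\<^sub>E i\<in>I. X i)"
  proof -
    have "p i ! j \<in> X i" if "i \<in> I" "j < m" for i j
      using p_lists p_len that by (metis in_lists_conv_set nth_mem)
    then show ?thesis
      by (auto simp: w_def)
  qed
  have "map (\<lambda>f. f i) w = p i" if "i \<in> I" for i
    using that p_len[OF that] by (auto simp: w_def intro!: nth_equalityI)
  then have "word_value (product_group I G) w i = g i" if "i \<in> I" for i
    using that p_val by (simp add: word_value_product)
  moreover have "word_value (product_group I G) w \<in> carrier (product_group I G)"
    using w PiE_gens_carrier group by (intro group.word_value_closed product_group) auto
  ultimately have "word_value (product_group I G) w = g"
    using g by (intro PiE_ext[of _ I "\<lambda>i. carrier (G i)"]) auto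
  moreover have "length w = m"
    by (simp add: w_def)
  ultimately show ?thesis
    using w by blast
qed

lemma symmetric_generating_set_product:
  "symmetric_generating_set (product_group I G) (\<Pi>\<^sub>E i\<in>I. X i)"
proof -
  let ?P = "product_group I G"
  interpret P: group ?P
    using group by simp
  have "inv\<^bsub>?P\<^esub> x \<in> (\<Pi>\<^sub>E i\<in>I. X i)" if "x \<in> (\<Pi>\<^sub>E i\<in>I. X i)" for x
  proof -
    have "inv\<^bsub>?P\<^esub> x = (\<lambda>i\<in>I. inv\<^bsub>G i\<^esub> x i)"
      using that PiE_gens_carrier group by (intro inv_product_group) auto
    with that gens show ?thesis
      by (auto simp: PiE_iff symmetric_generating_set_def)
  qed
  moreover have "g \<in> word_value ?P ` lists (\<Pi>\<^sub>E i\<in>I. X i)" if g: "g \<in> carrier ?P" for g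
  proof -
    have "\<exists>v\<in>lists (X i). word_value (G i) v = g i" if "i \<in> I" for i
      using g that gens group.symmetric_generating_set_iff_words[OF group[OF that]]
      by (fastforce simp: PiE_iff)
    then obtain v where v: "\<And>i. i \<in> I \<Longrightarrow> v i \<in> lists (X i) \<and> word_value (G i) (v i) = g i"
      by metis
    have "length (v i) \<le> (\<Sum>i\<in>I. length (v i))" if "i \<in> I" for i
      using that finite_index by (intro member_le_sum) auto
    with v have "\<exists>w\<in>lists (\<Pi>\<^sub>E i\<in>I. X i). length w = (\<Sum>i\<in>I. length (v i)) \<and> word_value ?P w = g"
      by (intro ex_product_word[OF g]) blast
    then show ?thesis by auto
  qed
  ultimately show ?thesis
    using PiE_gens_carrier by (auto simp only: P.symmetric_generating_set_iff_words)
qed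

text \<open>
  A shorter word for the same element has shorter words as its components, so one geodesic component
  makes the word geodesic. Conversely, if every component of a word of length \<open>n\<close> can be shortened,
  then all of them can be shortened to length at most \<open>n - 1\<close>, and these shorter words combine into a
  word of length \<open>n - 1\<close> for the same element.
\<close>

lemma Geo_product:
  assumes "I \<noteq> {}"
  shows "Geo (product_group I G) (\<Pi>\<^sub>E i\<in>I. X i) =
    (\<Union>i\<in>I. {w \<in> lists (\<Pi>\<^sub>E i\<in>I. X i). map (\<lambda>f. f i) w \<in> Geo (G i) (X i)})"
    (is "Geo ?P ?Z = ?R")
proof
  show "?R \<subseteq> Geo ?P ?Z"
  proof
    fix w assume "w \<in> ?R"
    then obtain i where i: "i \<in> I" "w \<in> lists ?Z" "map (\<lambda>f. f i) w \<in> Geo (G i) (X i)"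
      by blast
    have False if "v \<in> lists ?Z" "length v < length w" "word_value ?P v = word_value ?P w" for v
    proof -
      have "word_value (G i) (map (\<lambda>f. f i) v) = word_value (G i) (map (\<lambda>f. f i) w)"
        using that(3) i(1) word_value_product by metis
      moreover have "map (\<lambda>f. f i) v \<in> lists (X i)"
        using i(1) that(1) by (rule map_component_lists)
      moreover have "length (map (\<lambda>f. f i) v) < length (map (\<lambda>f. f i) w)"
        using that(2) by simp
      ultimately show False
        using i(3) unfolding Geo_def by blast
    qed
    with i(2) show "w \<in> Geo ?P ?Z"
      by (auto simp: Geo_def)
  qed
next
  show "Geo ?P ?Z \<subseteq> ?R"
  proof (rule subsetI, rule ccontr)
    fix w assume w: "w \<in> Geo ?P ?Z" and "w \<notin> ?R"
    then have wZ: "w \<in> lists ?Z"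
      by (simp add: Geo_def)
    have short: "\<exists>v\<in>lists (X i). length v < length w \<and> word_value (G i) v = word_value ?P w i"
      if "i \<in> I" for i
    proof -
      have "map (\<lambda>f. f i) w \<notin> Geo (G i) (X i)"
        using \<open>w \<notin> ?R\<close> that wZ by blast
      with map_component_lists[OF that wZ] show ?thesis
        by (auto simp: Geo_def word_value_product[OF that])
    qed
    \<comment> \<open>Some component can be shortened, so \<open>w\<close> is not empty and \<open>length w - 1\<close> is not truncated.\<close>
    have pos: "length w > 0"
      using short assms by fastforce
    have "word_value ?P w \<in> carrier ?P"
      using wZ PiE_gens_carrier group by (intro group.word_value_closed product_group) auto
    then have "\<exists>v\<in>lists ?Z. length v = length w - 1 \<and> word_value ?P v = word_value ?P w"
    proof (rule ex_product_word)
      show "\<exists>v\<in>lists (X i). length v \<le> length w - 1 \<and> word_value (G i) v = word_value ?P w i"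
        if "i \<in> I" for i
        using short[OF that] by (auto simp: less_eq_Suc_le intro!: bexI)
    qed
    then obtain v where "v \<in> lists ?Z" "length v = length w - 1" "word_value ?P v = word_value ?P w"
      by blast
    moreover from this pos have "length v < length w"
      by simp
    ultimately show False
      using w unfolding Geo_def by blast
  qed
qed

lemma locally_testable_Geo_product:
  assumes "I \<noteq> {}" "\<And>i. i \<in> I \<Longrightarrow> locally_testable k (X i) (Geo (G i) (X i))"
  shows "locally_testable k (\<Pi>\<^sub>E i\<in>I. X i) (Geo (product_group I G) (\<Pi>\<^sub>E i\<in>I. X i))"
  unfolding Geo_product[OF assms(1)]
proof (rule locally_testable_UN)
  fix i assume i: "i \<in> I"
  then have "(\<lambda>f. f i) \<in> (\<Pi>\<^sub>E i\<in>I. X i) \<rightarrow> X i"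
    by auto
  then show "locally_testable k (\<Pi>\<^sub>E i\<in>I. X i)
      {w \<in> lists (\<Pi>\<^sub>E i\<in>I. X i). map (\<lambda>f. f i) w \<in> Geo (G i) (X i)}"
    using assms(2)[OF i] by (rule locally_testable_preimage)
qed

end

theorem theorem4p1:
  fixes k n :: nat and G :: "nat \<Rightarrow> ('a, 'b) monoid_scheme"
  assumes "k > 0" and "n \<ge> 1"
    and "\<And>i. i \<in> {1..n} \<Longrightarrow> locally_testable_group k (G i)"
  shows "locally_testable_group k (product_group {1..n} G)"
proof -
  have "\<exists>X. finite X \<and> symmetric_generating_set (G i) X \<and> \<one>\<^bsub>G i\<^esub> \<in> X \<and>
      locally_testable k X (Geo (G i) X)" if "i \<in> {1..n}" for i
    by (rule locally_testable_groupE_one[OF assms(3)[OF that] assms(1)]) blast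
  then obtain X where X: "\<And>i. i \<in> {1..n} \<Longrightarrow> finite (X i) \<and>
      symmetric_generating_set (G i) (X i) \<and> \<one>\<^bsub>G i\<^esub> \<in> X i \<and>
      locally_testable k (X i) (Geo (G i) (X i))"
    by metis
  have group: "\<And>i. i \<in> {1..n} \<Longrightarrow> group (G i)"
    using assms(3) by (simp add: locally_testable_group_def)
  interpret generated_groups "{1..n}" G X
    by (rule generated_groups.intro) (use X group in auto)
  have "finite (\<Pi>\<^sub>E i\<in>{1..n}. X i)"
    using X by (intro finite_PiE) auto
  moreover have "locally_testable k (\<Pi>\<^sub>E i\<in>{1..n}. X i)
      (Geo (product_group {1..n} G) (\<Pi>\<^sub>E i\<in>{1..n}. X i))"
    using X assms(2) by (intro locally_testable_Geo_product) auto
  moreover have "group (product_group {1..n} G)"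
    using group by (rule product_group)
  ultimately show ?thesis
    using symmetric_generating_set_product unfolding locally_testable_group_def by blast
qed

end
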